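(* Let $\lambda\in\mathbb C\setminus\{0\}$, let $a$ be a positive integer and let $R\in x^{a}\mathbb C\{x,y\}$. Consider $X_R=\lambda x\frac{\partial}{\partial x}+(1+R)y\frac{\partial}{\partial y}$ on a polydisc $\mathcal U=\rho\mathbb D\times r\mathbb D$ on which $R$ is holomorphic, bounded, and satisfies $\sup_{\mathcal U}|R|<1$. Let $\mathcal E:(z,w)\mapsto(e^{z},e^{w})$ be the universal covering of $\hat{\mathcal U}=\mathcal U\setminus\{xy=0\}$ by $\tilde{\mathcal U}=\{\operatorname{Re} z<\ln\rho,\ \operatorname{Re} w<\ln r\}$. Then the pulled-back foliation $\mathcal E^{*}\mathcal F_R$ on $\tilde{\mathcal U}$ is regular (nonsingular), and each of its leaves is simply connected.
   Context: $\mathcal F_R$ denotes the holomorphic foliation of $\mathcal U$ whose leaves are the integral curves of $X_R$. The foliation $\mathcal E^{*}\mathcal F_R$ on $\tilde{\mathcal U}$ is the foliation by integral curves of $\mathcal E^{*}X_R=\lambda\frac{\partial}{\partial z}+(1+R\circ\mathcal E)\frac{\partial}{\partial w}$. *)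

theory Defs
  imports "HOL-Analysis.Analysis"
begin

definition holo2 :: "(complex \<times> complex \<Rightarrow> complex) \<Rightarrow> (complex \<times> complex) set \<Rightarrow> bool" where
  "holo2 f S \<longleftrightarrow> (\<forall>p\<in>S. \<exists>a b. (f has_derivative (\<lambda>(h, k). a * h + b * k)) (at p))"

definition polydisc :: "real \<Rightarrow> real \<Rightarrow> (complex \<times> complex) set" where
  "polydisc \<rho> r = {(x, y). norm x < \<rho> \<and> norm y < r}"

definition cover_dom :: "real \<Rightarrow> real \<Rightarrow> (complex \<times> complex) set" where
  "cover_dom \<rho> r = {(z, w). Re z < ln \<rho> \<and> Re w < ln r}"

definition covE :: "complex \<times> complex \<Rightarrow> complex \<times> complex" where
  "covE p = (exp (fst p), exp (snd p))"

definition pullback_field :: "complex \<Rightarrow> (complex \<times> complex \<Rightarrow> complex) \<Rightarrow> complex \<times> complex \<Rightarrow> complex \<times> complex" where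
  "pullback_field lam R p = (lam, 1 + R (covE p))"

definition integral_curve :: "(complex \<times> complex \<Rightarrow> complex \<times> complex) \<Rightarrow> (complex \<times> complex) set
    \<Rightarrow> complex set \<Rightarrow> (complex \<Rightarrow> complex \<times> complex) \<Rightarrow> bool" where
  "integral_curve V S D \<gamma> \<longleftrightarrow> open D \<and> connected D \<and> \<gamma> ` D \<subseteq> S \<and>
     (\<forall>t\<in>D. (\<gamma> has_derivative (\<lambda>h. (h * fst (V (\<gamma> t)), h * snd (V (\<gamma> t))))) (at t))"

text \<open>The leaf topology of the foliation by integral curves of V on S: generated by the
  images of open pieces of integral curves (plaques).\<close>
definition leaf_topology :: "(complex \<times> complex \<Rightarrow> complex \<times> complex) \<Rightarrow> (complex \<times> complex) set
    \<Rightarrow> (complex \<times> complex) topology" where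
  "leaf_topology V S = topology_generated_by
     {\<gamma> ` W | \<gamma> D W. integral_curve V S D \<gamma> \<and> open W \<and> W \<subseteq> D}"

definition leaf :: "(complex \<times> complex \<Rightarrow> complex \<times> complex) \<Rightarrow> (complex \<times> complex) set
    \<Rightarrow> complex \<times> complex \<Rightarrow> (complex \<times> complex) set" where
  "leaf V S p = connected_component_of_set (leaf_topology V S) p"

definition simply_connected_space :: "'a topology \<Rightarrow> bool" where
  "simply_connected_space X \<longleftrightarrow> path_connected_space X \<and>
     (\<forall>g. pathin X g \<and> g 1 = g 0 \<longrightarrow>
        homotopic_with (\<lambda>h. h 1 = h 0) (top_of_set {0..1}) X g (\<lambda>_. g 0))"

end

theory Submission
  imports Defs "HOL-Complex_Analysis.Complex_Analysis"
begin

text \<open>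
  In the time \<open>t = z / lam\<close>, integral curves become graphs of solutions of
  \<open>w' = 1 + R (exp (lam * t), exp w)\<close> over open subsets of the half plane
  \<open>H = {t. Re (lam * t) < ln \<rho>}\<close>. As \<open>sup \<bar>R\<bar> < 1\<close>, the real part of \<open>w\<close> decreases when \<open>t\<close> moves
  backwards along the reals, so a solution can always be continued backwards as long as \<open>t\<close> stays
  in \<open>H\<close>. A connected open subset of \<open>H\<close> that is closed under backward translation is simply
  connected: from a point of \<open>H\<close> outside of the subset, the forward ray to infinity avoids it too.
  Two such subsets that meet therefore have a simply connected union, and thus, in the plane,
  a connected intersection. Hence solutions over such sets glue, and every leaf is the graph of one
  maximal solution over such a set.
\<close>

subsection \<open>Simple connectivity\<close>

lemma outside_if_ray_disjoint:
  fixes S :: "'a :: real_normed_vector set"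
  assumes "d \<noteq> 0" and ray: "\<And>s. s \<ge> 0 \<Longrightarrow> z + s *\<^sub>R d \<notin> S"
  shows "z \<in> outside S"
  unfolding outside_connected_component_lt
proof (intro CollectI allI)
  fix B
  define s where "s = (\<bar>B\<bar> + norm z + 1) / norm d"
  have "s \<ge> 0" "norm (s *\<^sub>R d) = \<bar>B\<bar> + norm z + 1"
    using \<open>d \<noteq> 0\<close> by (auto simp: s_def)
  then have "B < norm (z + s *\<^sub>R d)"
    using norm_diff_ineq[of "s *\<^sub>R d" z] by (simp add: add.commute)
  moreover have "connected_component (- S) z (z + s *\<^sub>R d)"
    unfolding connected_component_def
  proof (intro exI conjI)
    show "connected ((\<lambda>s. z + s *\<^sub>R d) ` {0..})"
      by (intro connected_continuous_image continuous_intros) auto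
  qed (use ray \<open>s \<ge> 0\<close> in \<open>auto simp: image_iff intro: bexI[of _ 0]\<close>)
  ultimately show "\<exists>y. B < norm y \<and> connected_component (- S) z y"
    by blast
qed

lemma connected_Int_if_simply_connected_Un:
  fixes S T :: "complex set"
  assumes S: "open S" "connected S" and T: "open T" "connected T"
    and Un: "simply_connected (S \<union> T)"
  shows "connected (S \<inter> T)"
proof (cases "S \<union> T = {}")
  case False
  have "S \<union> T homeomorphic ball (0 :: complex) 1"
    using False Un S(1) T(1) simply_connected_eq_homeomorphic_to_disc[of "S \<union> T"] by auto
  also have "ball (0 :: complex) 1 homeomorphic (UNIV :: complex set)"
    by (simp add: homeomorphic_ball_UNIV)
  finally obtain f g where hom: "homeomorphism (S \<union> T) (UNIV :: complex set) f g"
    unfolding homeomorphic_def by blast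
  have image: "open (f ` W)" "connected (f ` W)" if "W \<subseteq> S \<union> T" "open W" "connected W" for W
    using that homeomorphism_imp_open_map[OF hom, of W] homeomorphism_cont1[OF hom]
    by (auto simp: open_subset intro: connected_continuous_image continuous_on_subset)
  have "connected (f ` S \<inter> f ` T)"
    using homeomorphism_image1[OF hom] S T by (intro open_unicoherent_UNIV image) auto
  then have "connected (g ` (f ` S \<inter> f ` T))"
    using homeomorphism_cont2[OF hom] continuous_on_subset
    by (intro connected_continuous_image) auto
  moreover have "g ` (f ` S \<inter> f ` T) = S \<inter> T"
    using homeomorphism_apply1[OF hom] by (force simp: image_iff)
  ultimately show ?thesis
    by simp
qed auto

lemma simply_connected_space_top_of_set:
  fixes U :: "'a :: real_normed_vector set"
  assumes "simply_connected U"
  shows "simply_connected_space (top_of_set U)"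
  unfolding simply_connected_space_def
proof (intro conjI allI impI)
  show "path_connected_space (top_of_set U)"
    using assms by (simp add: simply_connected_imp_path_connected)
  fix g assume "pathin (top_of_set U) g \<and> g 1 = g 0"
  then have "path g" "path_image g \<subseteq> U" "pathfinish g = pathstart g" "g 0 \<in> U"
    by (auto simp: pathin_canon_iff path_image_def pathfinish_def pathstart_def)
  then have "homotopic_loops U g (linepath (g 0) (g 0))"
    using assms by (simp add: simply_connected_eq_contractible_loop_any)
  then show "homotopic_with (\<lambda>h. h 1 = h 0) (top_of_set {0..1}) (top_of_set U) g (\<lambda>_. g 0)"
    by (simp add: homotopic_loops_def pathfinish_def pathstart_def linepath_refl)
qed

lemma simply_connected_space_retraction_map_image:
  assumes r: "retraction_map X Y r" and X: "simply_connected_space X"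
  shows "simply_connected_space Y"
  unfolding simply_connected_space_def
proof (intro conjI allI impI)
  show "path_connected_space Y"
    using path_connected_space_retraction_map_image[OF r] X by (simp add: simply_connected_space_def)
  obtain s where s: "continuous_map X Y r" "continuous_map Y X s"
    "\<And>y. y \<in> topspace Y \<Longrightarrow> r (s y) = y"
    using r by (auto simp: retraction_map_def retraction_maps_def)
  fix g assume g: "pathin Y g \<and> g 1 = g 0"
  then have "homotopic_with (\<lambda>h. h 1 = h 0) (top_of_set {0..1}) X (s \<circ> g) (\<lambda>_. s (g 0))"
    using X pathin_compose[OF _ s(2), of g] by (auto simp: simply_connected_space_def o_def)
  then have "homotopic_with (\<lambda>h. h 1 = h 0) (top_of_set {0..1}) Y
      (r \<circ> (s \<circ> g)) (r \<circ> (\<lambda>_. s (g 0)))"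
    using s(1) by (rule homotopic_with_compose_continuous_map_left) auto
  moreover have "g x \<in> topspace Y" if "x \<in> {0..1}" for x
    using g that by (auto simp: pathin_def continuous_map_def)
  ultimately show "homotopic_with (\<lambda>h. h 1 = h 0) (top_of_set {0..1}) Y g (\<lambda>_. g 0)"
    using s(3) by (elim homotopic_with_eq) auto
qed

subsection \<open>Sets closed under backward translation\<close>

definition backward_closed :: "complex set \<Rightarrow> complex set \<Rightarrow> bool" where
  "backward_closed H U \<longleftrightarrow> (\<forall>t\<in>U. \<forall>s\<ge>0. t - of_real s \<in> H \<longrightarrow> t - of_real s \<in> U)"

lemma backward_closed_Union:
  assumes "\<And>U. U \<in> \<U> \<Longrightarrow> backward_closed H U"
  shows "backward_closed H (\<Union>\<U>)"
  using assms unfolding backward_closed_def by blast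

lemma simply_connected_backward_closed:
  assumes "convex H" and U: "open U" "connected U" "U \<subseteq> H" "backward_closed H U"
  shows "simply_connected U"
proof -
  have "z \<in> outside U" if "z \<notin> U" for z
  proof (cases "z \<in> H")
    case True
    have "z + s *\<^sub>R 1 \<notin> U" if "s \<ge> 0" for s
    proof
      assume "z + s *\<^sub>R 1 \<in> U"
      moreover have "z + s *\<^sub>R 1 - of_real s = z"
        by (simp add: scaleR_conv_of_real)
      ultimately show False
        using U(4) \<open>z \<in> H\<close> \<open>z \<notin> U\<close> that unfolding backward_closed_def by metis
    qed
    then show ?thesis
      by (intro outside_if_ray_disjoint[where d = 1]) auto
  next
    case False
    then show ?thesis
      using convex_in_outside[OF \<open>convex H\<close>] outside_mono[OF U(3)] by blast
  qed
  then have "inside U = {}"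
    by (auto simp: inside_outside)
  with U(1,2) show ?thesis
    by (simp add: simply_connected_eq_empty_inside)
qed

lemma connected_Int_backward_closed:
  assumes "convex H" and U: "open U" "connected U" "U \<subseteq> H" "backward_closed H U"
    and V: "open V" "connected V" "V \<subseteq> H" "backward_closed H V"
  shows "connected (U \<inter> V)"
proof (cases "U \<inter> V = {}")
  case False
  have "simply_connected (U \<union> V)"
  proof (rule simply_connected_backward_closed[OF \<open>convex H\<close>])
    show "connected (U \<union> V)"
      using U V False by (intro connected_Un)
    show "backward_closed H (U \<union> V)"
      using backward_closed_Union[of "{U, V}"] U V by auto
  qed (use U V in auto)
  then show ?thesis
    using U V by (intro connected_Int_if_simply_connected_Un)
qed auto

subsection \<open>Holomorphic maps\<close>

lemma holo2_subset: "holo2 f A \<Longrightarrow> B \<subseteq> A \<Longrightarrow> holo2 f B"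
  unfolding holo2_def by blast

lemma holo2_const_add:
  assumes "holo2 f A"
  shows "holo2 (\<lambda>p. k + f p) A"
  unfolding holo2_def
proof
  fix p assume "p \<in> A"
  then obtain a b where "(f has_derivative (\<lambda>(h, k). a * h + b * k)) (at p)"
    using assms unfolding holo2_def by blast
  from has_derivative_add[OF has_derivative_const this, of k]
  show "\<exists>a b. ((\<lambda>p. k + f p) has_derivative (\<lambda>(h, k). a * h + b * k)) (at p)"
    by auto
qed

lemma has_derivative_holo2_compose:
  assumes "holo2 f A" "(u x, v x) \<in> A"
    and u: "(u has_derivative u') (at x)" and v: "(v has_derivative v') (at x)"
  obtains a b where "((\<lambda>x. f (u x, v x)) has_derivative (\<lambda>h. a * u' h + b * v' h)) (at x)"
proof -
  obtain a b where "(f has_derivative (\<lambda>(h, k). a * h + b * k)) (at (u x, v x))"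
    using assms(1,2) unfolding holo2_def by blast
  from has_derivative_compose[OF has_derivative_Pair[OF u v] this] show ?thesis
    by (intro that) simp
qed

lemma holomorphic_on_holo2_compose:
  assumes f: "holo2 f A" and U: "open U" "u holomorphic_on U" "v holomorphic_on U"
    and A: "\<And>t. t \<in> U \<Longrightarrow> (u t, v t) \<in> A"
  shows "(\<lambda>t. f (u t, v t)) holomorphic_on U"
  unfolding holomorphic_on_open[OF U(1)]
proof
  fix t assume t: "t \<in> U"
  have "(u has_derivative (*) (deriv u t)) (at t)" "(v has_derivative (*) (deriv v t)) (at t)"
    using holomorphic_derivI[OF U(2,1) t] holomorphic_derivI[OF U(3,1) t]
    by (auto simp: has_field_derivative_def)
  then obtain a b where
    "((\<lambda>t. f (u t, v t)) has_derivative (\<lambda>h. a * (deriv u t * h) + b * (deriv v t * h))) (at t)"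
    by (rule has_derivative_holo2_compose[of f A u t v, OF f A[OF t]])
  then have "((\<lambda>t. f (u t, v t)) has_derivative (*) (a * deriv u t + b * deriv v t)) (at t)"
    by (rule has_derivative_eq_rhs) (auto simp: algebra_simps)
  then show "\<exists>f'. ((\<lambda>t. f (u t, v t)) has_field_derivative f') (at t)"
    unfolding has_field_derivative_def by blast
qed

lemma holo2_compose_Times:
  assumes f: "holo2 f A" and u: "open T" "u holomorphic_on T" and v: "open W" "v holomorphic_on W"
    and A: "\<And>t w. t \<in> T \<Longrightarrow> w \<in> W \<Longrightarrow> (u t, v w) \<in> A"
  shows "holo2 (\<lambda>(t, w). f (u t, v w)) (T \<times> W)"
  unfolding holo2_def
proof clarify
  fix t w assume tw: "t \<in> T" "w \<in> W"
  have "(u has_derivative (*) (deriv u t)) (at (fst (t, w)))"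
    using holomorphic_derivI[OF u(2,1) tw(1)] by (simp add: has_field_derivative_def)
  then have deriv_u: "((\<lambda>p. u (fst p)) has_derivative (\<lambda>p. deriv u t * fst p)) (at (t, w))"
    by (rule has_derivative_compose[OF has_derivative_fst[OF has_derivative_ident]])
  have "(v has_derivative (*) (deriv v w)) (at (snd (t, w)))"
    using holomorphic_derivI[OF v(2,1) tw(2)] by (simp add: has_field_derivative_def)
  then have deriv_v: "((\<lambda>p. v (snd p)) has_derivative (\<lambda>p. deriv v w * snd p)) (at (t, w))"
    by (rule has_derivative_compose[OF has_derivative_snd[OF has_derivative_ident]])
  obtain a b where "((\<lambda>p. f (u (fst p), v (snd p))) has_derivative
      (\<lambda>p. a * (deriv u t * fst p) + b * (deriv v w * snd p))) (at (t, w))"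
    by (rule has_derivative_holo2_compose[OF f _ deriv_u deriv_v]) (simp add: A[OF tw])
  then have "((\<lambda>(t, w). f (u t, v w)) has_derivative
      (\<lambda>(h, k). (a * deriv u t) * h + (b * deriv v w) * k)) (at (t, w))"
    by (simp add: case_prod_beta' mult.assoc)
  then show "\<exists>a b. ((\<lambda>(t, w). f (u t, v w)) has_derivative (\<lambda>(h, k). a * h + b * k)) (at (t, w))"
    by blast
qed

lemma holomorphic_bounded_imp_lipschitz_on:
  assumes h: "h holomorphic_on A" and bound: "\<And>w. w \<in> A \<Longrightarrow> norm (h w) \<le> B" and "B \<ge> 0"
    and "convex S" "d > 0" and sub: "\<And>w. w \<in> S \<Longrightarrow> cball w d \<subseteq> A"
  shows "(B / d)-lipschitz_on S h"
proof (rule lipschitz_onI)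
  fix w w' assume w: "w \<in> S" "w' \<in> S"
  have "norm (h w - h w') \<le> B / d * norm (w - w')"
  proof (rule field_differentiable_bound[OF \<open>convex S\<close>, where f' = "deriv h"])
    fix x assume "x \<in> S"
    then have cball: "cball x d \<subseteq> A"
      by (rule sub)
    then have ball: "h holomorphic_on ball x d"
      using h ball_subset_cball holomorphic_on_subset by blast
    then show "(h has_field_derivative deriv h x) (at x within S)"
      using \<open>d > 0\<close> holomorphic_derivI[OF ball open_ball] has_field_derivative_at_within by force
    have "norm ((deriv ^^ 1) h x) \<le> fact 1 * B / d ^ 1"
    proof (rule Cauchy_inequality[OF ball _ \<open>d > 0\<close>])
      show "continuous_on (cball x d) h"
        using h cball holomorphic_on_subset holomorphic_on_imp_continuous_on by blast
      show "norm (h y) \<le> B" if "norm (x - y) = d" for y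
        using that cball by (intro bound) (auto simp: dist_norm)
    qed
    then show "norm (deriv h x) \<le> B / d"
      by simp
  qed (use w in auto)
  then show "dist (h w) (h w') \<le> B / d * dist w w'"
    by (simp add: dist_norm)
qed (use assms in auto)

lemma norm_diff_le_radial_majorant:
  fixes v v' :: "'a :: real_normed_field \<Rightarrow> 'a"
  assumes D: "convex D" "t0 \<in> D" "t \<in> D"
    and deriv: "\<And>s. s \<in> D \<Longrightarrow> (v has_field_derivative v' s) (at s)"
    and deriv_\<phi>: "\<And>x. (\<phi> has_real_derivative \<phi>' x) (at x)"
    and bound: "\<And>s. s \<in> D \<Longrightarrow> norm (v' s) \<le> \<phi>' (norm (s - t0))"
  shows "norm (v t - v t0) \<le> \<phi> (norm (t - t0)) - \<phi> 0"
proof -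
  define p where "p x = linepath t0 t x" for x
  define \<psi> where "\<psi> x = \<phi> (norm (t - t0) * x)" for x
  have p: "p x \<in> D" if "x \<in> {0..1}" for x
    unfolding p_def using that D closed_segment_subset linepath_in_path by blast
  have deriv_vp: "((\<lambda>x. v (p x)) has_vector_derivative (t - t0) * v' (p x)) (at x)" if "x \<in> {0..1}" for x
    unfolding p_def using deriv[OF p[OF that]] has_vector_derivative_linepath_within[of t0 t x UNIV]
    by (intro field_vector_diff_chain_at[unfolded o_def]) (auto simp: p_def)
  have deriv_\<psi>: "(\<psi> has_vector_derivative norm (t - t0) * \<phi>' (norm (t - t0) * x)) (at x)" for x
    unfolding \<psi>_def has_real_derivative_iff_has_vector_derivative[symmetric]
    by (rule DERIV_cong[OF DERIV_chain2[OF deriv_\<phi>]]) (auto intro!: derivative_eq_intros)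
  have "norm (v (p 1) - v (p 0)) \<le> \<psi> 1 - \<psi> 0"
  proof (rule differentiable_bound_general[where f = "\<lambda>x. v (p x)"])
    show "continuous_on {0..1} (\<lambda>x. v (p x))" "continuous_on {0..1} \<psi>"
      using deriv_vp deriv_\<psi> by (meson continuous_at_imp_continuous_on has_vector_derivative_continuous)+
    fix x :: real assume x: "0 < x" "x < 1"
    have "p x - t0 = x *\<^sub>R (t - t0)"
      by (simp add: p_def linepath_def algebra_simps)
    then have "norm (v' (p x)) \<le> \<phi>' (norm (t - t0) * x)"
      using bound[of "p x"] p[of x] x by (simp add: mult.commute)
    then show "norm ((t - t0) * v' (p x)) \<le> norm (t - t0) * \<phi>' (norm (t - t0) * x)"
      by (simp add: norm_mult mult_left_mono)
  qed (use deriv_vp deriv_\<psi> in auto)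
  then show ?thesis
    by (simp add: p_def \<psi>_def linepath_def)
qed

lemma zero_on_cball_if_norm_deriv_le:
  fixes v v' :: "complex \<Rightarrow> complex"
  assumes deriv: "\<And>t. t \<in> cball t0 e \<Longrightarrow> (v has_field_derivative v' t) (at t)"
    and bound: "\<And>t. t \<in> cball t0 e \<Longrightarrow> norm (v' t) \<le> M * norm (v t)"
    and "v t0 = 0" "M \<ge> 0" "M * e < 1" and t: "t \<in> cball t0 e"
  shows "v t = 0"
proof -
  have "continuous_on (cball t0 e) (\<lambda>t. norm (v t))"
    using deriv by (intro continuous_on_norm continuous_at_imp_continuous_on) (blast intro: DERIV_isCont)
  then obtain x where x: "x \<in> cball t0 e"
    and max: "\<And>t. t \<in> cball t0 e \<Longrightarrow> norm (v t) \<le> norm (v x)"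
    using continuous_attains_sup[OF compact_cball] t by (metis empty_iff)
  have "norm (v x - v t0) \<le> (M * norm (v x)) * norm (x - t0)"
  proof (rule field_differentiable_bound[OF convex_cball])
    fix s assume s: "s \<in> cball t0 e"
    show "(v has_field_derivative v' s) (at s within cball t0 e)"
      using deriv[OF s] by (rule has_field_derivative_at_within)
    show "norm (v' s) \<le> M * norm (v x)"
      using bound[OF s] mult_left_mono[OF max[OF s] \<open>M \<ge> 0\<close>] by linarith
  qed (use x in \<open>auto intro: order.trans[OF zero_le_dist]\<close>)
  also have "\<dots> \<le> (M * norm (v x)) * e"
    using x \<open>M \<ge> 0\<close> by (intro mult_left_mono) (auto simp: dist_norm norm_minus_commute)
  finally have "(1 - M * e) * norm (v x) \<le> 0"
    using \<open>v t0 = 0\<close> by (simp add: algebra_simps)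
  then have "norm (v x) \<le> 0"
    using \<open>M * e < 1\<close> by (simp add: mult_le_0_iff)
  then show ?thesis
    using max[OF t] by simp
qed

subsection \<open>Picard iteration\<close>

definition reachable :: "complex \<Rightarrow> real \<Rightarrow> complex \<Rightarrow> complex \<Rightarrow> complex \<Rightarrow> complex set" where
  "reachable b c t0 w0 t = cball (w0 + b * (t - t0)) (c * norm (t - t0))"

locale picard_iteration =
  fixes D :: "complex set" and t0 w0 b :: complex and c M :: real
    and F :: "complex \<times> complex \<Rightarrow> complex"
  assumes open_D: "open D" and convex_D: "convex D" and t0_in_D: "t0 \<in> D" and M_pos: "M > 0"
    and holo2_F: "holo2 F (Sigma D (reachable b c t0 w0))"
    and F_in_cball: "\<And>t w. t \<in> D \<Longrightarrow> w \<in> reachable b c t0 w0 t \<Longrightarrow> F (t, w) \<in> cball b c"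
    and F_lipschitz: "\<And>t. t \<in> D \<Longrightarrow> M-lipschitz_on (reachable b c t0 w0 t) (\<lambda>w. F (t, w))"
begin

abbreviation "reach \<equiv> reachable b c t0 w0"

definition admissible :: "(complex \<Rightarrow> complex) \<Rightarrow> bool" where
  "admissible u \<longleftrightarrow> u holomorphic_on D \<and> (\<forall>t\<in>D. u t \<in> reach t)"

definition picard :: "(complex \<Rightarrow> complex) \<Rightarrow> complex \<Rightarrow> complex" where
  "picard u t = w0 + contour_integral (linepath t0 t) (\<lambda>s. F (s, u s))"

lemma c_nonneg: "c \<ge> 0"
proof -
  have "F (t0, w0) \<in> cball b c"
    by (rule F_in_cball[OF t0_in_D]) (simp add: reachable_def)
  then show ?thesis
    by (meson mem_cball order.trans zero_le_dist)
qed

lemma picard_initial: "picard u t0 = w0"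
  by (simp add: picard_def)

lemma has_field_derivative_picard:
  assumes u: "admissible u" and t: "t \<in> D"
  shows "(picard u has_field_derivative F (t, u t)) (at t)"
proof -
  have hol: "(\<lambda>s. F (s, u s)) holomorphic_on D"
    using u by (intro holomorphic_on_holo2_compose[OF holo2_F open_D]) (auto simp: admissible_def)
  have "((\<lambda>t. contour_integral (linepath t0 t) (\<lambda>s. F (s, u s))) has_field_derivative F (t, u t))
      (at t within D)"
  proof (rule triangle_contour_integrals_convex_primitive[OF _ t0_in_D convex_D t])
    show "continuous_on D (\<lambda>s. F (s, u s))"
      using hol by (rule holomorphic_on_imp_continuous_on)
    fix x y assume xy: "x \<in> D" "y \<in> D"
    have "((\<lambda>s. F (s, u s)) has_contour_integral 0) (linepath t0 x +++ linepath x y +++ linepath y t0)"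
      using hol convex_D by (rule Cauchy_theorem_convex_simple)
        (use xy t0_in_D convex_D in \<open>auto simp: path_image_join closed_segment_subset\<close>)
    then show "contour_integral (linepath t0 x) (\<lambda>s. F (s, u s)) +
        contour_integral (linepath x y) (\<lambda>s. F (s, u s)) +
        contour_integral (linepath y t0) (\<lambda>s. F (s, u s)) = 0"
      by (rule has_chain_integral_chain_integral3)
  qed
  then have "((\<lambda>t. contour_integral (linepath t0 t) (\<lambda>s. F (s, u s))) has_field_derivative F (t, u t))
      (at t)"
    using at_within_open[OF t open_D] by simp
  then show ?thesis
    unfolding picard_def by (auto intro!: derivative_eq_intros)
qed

lemma admissible_picard:
  assumes u: "admissible u"
  shows "admissible (picard u)"
  unfolding admissible_def
proof (intro conjI ballI)
  show "picard u holomorphic_on D"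
    using has_field_derivative_picard[OF u] open_D by (auto simp: holomorphic_on_open)
  fix t assume t: "t \<in> D"
  have "norm ((picard u t - b * t) - (picard u t0 - b * t0)) \<le> c * norm (t - t0)"
  proof (rule field_differentiable_bound[OF convex_D])
    fix s assume s: "s \<in> D"
    show "((\<lambda>t. picard u t - b * t) has_field_derivative F (s, u s) - b) (at s within D)"
      by (rule has_field_derivative_at_within, rule derivative_eq_intros)
        (auto intro!: derivative_eq_intros has_field_derivative_picard[OF u s])
    show "norm (F (s, u s) - b) \<le> c"
      using F_in_cball[OF s] u s by (simp add: admissible_def dist_norm norm_minus_commute)
  qed (use t t0_in_D in auto)
  then show "picard u t \<in> reach t"
    by (simp add: reachable_def picard_initial dist_norm norm_minus_commute algebra_simps)
qed

text \<open>In the norm with weight \<open>exp (- 2 * M * norm (t - t0))\<close> the operator is a contraction on all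
  of \<open>D\<close>, which need not be bounded.\<close>
lemma norm_picard_diff_le:
  assumes u: "admissible u" and v: "admissible v"
    and bound: "\<And>t. t \<in> D \<Longrightarrow> norm (u t - v t) \<le> k * exp (2 * M * norm (t - t0))" and t: "t \<in> D"
  shows "norm (picard u t - picard v t) \<le> k / 2 * exp (2 * M * norm (t - t0))"
proof -
  have "k \<ge> 0"
    using order.trans[OF norm_ge_zero bound[OF t0_in_D]] by simp
  have "norm ((picard u t - picard v t) - (picard u t0 - picard v t0))
      \<le> k / 2 * exp (2 * M * norm (t - t0)) - k / 2 * exp (2 * M * 0)"
  proof (rule norm_diff_le_radial_majorant[OF convex_D t0_in_D t])
    fix s assume s: "s \<in> D"
    show "((\<lambda>t. picard u t - picard v t) has_field_derivative F (s, u s) - F (s, v s)) (at s)"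
      using u v s by (intro DERIV_diff has_field_derivative_picard)
    have "norm (F (s, u s) - F (s, v s)) \<le> M * norm (u s - v s)"
      using lipschitz_onD[OF F_lipschitz[OF s]] u v s by (simp add: admissible_def dist_norm)
    also have "\<dots> \<le> M * (k * exp (2 * M * norm (s - t0)))"
      using M_pos bound[OF s] by (intro mult_left_mono) auto
    finally show "norm (F (s, u s) - F (s, v s)) \<le> M * (k * exp (2 * M * norm (s - t0)))" .
  qed (auto intro!: derivative_eq_intros)
  then show ?thesis
    using \<open>k \<ge> 0\<close> by (simp add: picard_initial)
qed

definition iterate :: "nat \<Rightarrow> complex \<Rightarrow> complex" where
  "iterate n = (picard ^^ n) (\<lambda>t. w0 + b * (t - t0))"

lemma admissible_iterate: "admissible (iterate n)"
proof (induction n)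
  case 0
  show ?case
    using c_nonneg by (auto simp: iterate_def admissible_def reachable_def intro!: holomorphic_intros)
next
  case (Suc n)
  then show ?case
    by (simp add: iterate_def admissible_picard)
qed

lemma iterate_in_reach: "t \<in> D \<Longrightarrow> iterate n t \<in> reach t"
  using admissible_iterate by (simp add: admissible_def)

lemma norm_iterate_diff_le:
  "t \<in> D \<Longrightarrow> norm (iterate (Suc n) t - iterate n t) \<le> c / M * (1 / 2) ^ n * exp (2 * M * norm (t - t0))"
proof (induction n arbitrary: t)
  case 0
  have "norm (iterate 1 t - iterate 0 t) \<le> c * norm (t - t0)"
    using iterate_in_reach[OF 0, of 1]
    by (simp add: reachable_def iterate_def dist_norm norm_minus_commute)
  also have "\<dots> \<le> c * (exp (2 * M * norm (t - t0)) / M)"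
  proof (rule mult_left_mono[OF _ c_nonneg])
    have "M * norm (t - t0) \<le> 1 + 2 * M * norm (t - t0)"
      using M_pos by simp
    also have "\<dots> \<le> exp (2 * M * norm (t - t0))"
      by (rule exp_ge_add_one_self)
    finally show "norm (t - t0) \<le> exp (2 * M * norm (t - t0)) / M"
      using M_pos by (simp add: field_simps)
  qed
  finally show ?case
    by simp
next
  case (Suc n)
  have "norm (picard (iterate (Suc n)) t - picard (iterate n) t)
      \<le> c / M * (1 / 2) ^ n / 2 * exp (2 * M * norm (t - t0))"
    using Suc by (intro norm_picard_diff_le admissible_iterate)
  then show ?case
    by (simp add: iterate_def)
qed

definition limit :: "complex \<Rightarrow> complex" where
  "limit t = iterate 0 t + (\<Sum>n. iterate (Suc n) t - iterate n t)"

lemma uniform_limit_iterate: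
  assumes "cball x d \<subseteq> D"
  shows "uniform_limit (cball x d) iterate limit sequentially"
proof -
  define C where "C = exp (2 * M * (norm (x - t0) + d))"
  have "norm (iterate (Suc n) t - iterate n t) \<le> c / M * (1 / 2) ^ n * C" if t: "t \<in> cball x d" for n t
  proof -
    have "norm (t - t0) \<le> norm (x - t0) + d"
      using t norm_triangle_ineq[of "t - x" "x - t0"] by (simp add: dist_norm norm_minus_commute)
    then have "exp (2 * M * norm (t - t0)) \<le> C"
      using M_pos by (simp add: C_def)
    then have "c / M * (1 / 2) ^ n * exp (2 * M * norm (t - t0)) \<le> c / M * (1 / 2) ^ n * C"
      using M_pos c_nonneg by (intro mult_left_mono) auto
    then show ?thesis
      using norm_iterate_diff_le[of t n] t assms by auto
  qed
  moreover have "summable (\<lambda>n. c / M * (1 / 2) ^ n * C)"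
    by (intro summable_mult summable_mult2 summable_geometric) auto
  ultimately have "uniform_limit (cball x d) (\<lambda>n t. \<Sum>i<n. iterate (Suc i) t - iterate i t)
      (\<lambda>t. \<Sum>n. iterate (Suc n) t - iterate n t) sequentially"
    by (rule Weierstrass_m_test)
  from uniform_limit_add[OF uniform_limit_const this, of "iterate 0"]
  show ?thesis
    unfolding limit_def by (simp add: sum_lessThan_telescope[of "\<lambda>n. iterate n _"])
qed

lemma iterate_tendsto_limit:
  assumes t: "t \<in> D"
  shows "(\<lambda>n. iterate n t) \<longlonglongrightarrow> limit t"
proof -
  obtain d where "d > 0" "cball t d \<subseteq> D"
    using open_D t open_contains_cball by blast
  then show ?thesis
    using tendsto_uniform_limitI[OF uniform_limit_iterate, of t d t] by auto
qed

lemma limit_initial: "limit t0 = w0"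
proof -
  have "iterate n t0 = w0" for n
    by (cases n) (auto simp: iterate_def picard_initial)
  then show ?thesis
    using iterate_tendsto_limit[OF t0_in_D] by (simp add: LIMSEQ_const_iff)
qed

lemma limit_in_reach:
  assumes t: "t \<in> D"
  shows "limit t \<in> reach t"
  unfolding reachable_def
  using iterate_in_reach[OF t]
  by (intro closed_sequentially[OF closed_cball _ iterate_tendsto_limit[OF t]])
    (simp add: reachable_def)

lemma has_field_derivative_limit:
  assumes t: "t \<in> D"
  shows "(limit has_field_derivative F (t, limit t)) (at t)"
proof -
  have "\<exists>g'. \<forall>t\<in>D. (limit has_field_derivative g' t) (at t) \<and> (\<lambda>n. F (t, iterate n t)) \<longlonglongrightarrow> g' t"
  proof (rule has_complex_derivative_uniform_sequence[OF open_D])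
    fix t assume t: "t \<in> D"
    show "(iterate (Suc n) has_field_derivative F (t, iterate n t)) (at t)" for n
      using has_field_derivative_picard[OF admissible_iterate t] by (simp add: iterate_def)
    obtain d where "d > 0" "cball t d \<subseteq> D"
      using open_D t open_contains_cball by blast
    then show "\<exists>d>0. cball t d \<subseteq> D \<and> uniform_limit (cball t d) (\<lambda>n. iterate (Suc n)) limit sequentially"
      using filterlim_compose[OF uniform_limit_iterate filterlim_Suc] by blast
  qed
  then obtain l where l: "(limit has_field_derivative l) (at t)" "(\<lambda>n. F (t, iterate n t)) \<longlonglongrightarrow> l"
    using t by blast
  have "(\<lambda>n. F (t, iterate n t)) \<longlonglongrightarrow> F (t, limit t)"
    using t by (intro continuous_on_tendsto_compose[OF lipschitz_on_continuous_on[OF F_lipschitz]]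
        iterate_tendsto_limit limit_in_reach always_eventually allI iterate_in_reach)
  then show ?thesis
    using l LIMSEQ_unique by metis
qed

end

subsection \<open>Solutions moving forward\<close>

lemma convex_on_imp_convex_sublevel:
  fixes f :: "'a :: real_vector \<Rightarrow> real"
  assumes f: "convex_on S f"
  shows "convex {x \<in> S. f x < k}"
  unfolding convex_alt
proof (intro ballI allI impI)
  fix x y and u :: real
  assume "x \<in> {x \<in> S. f x < k}" "y \<in> {x \<in> S. f x < k}" "0 \<le> u \<and> u \<le> 1"
  then have xy: "x \<in> S" "y \<in> S" "f x < k" "f y < k" and u: "0 \<le> u" "u \<le> 1"
    by auto
  have "f ((1 - u) *\<^sub>R x + u *\<^sub>R y) \<le> (1 - u) * f x + u * f y"
    using convex_onD[OF f u xy(1,2)] .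
  also have "\<dots> < k"
    using xy u by (intro convex_bound_lt) auto
  finally show "(1 - u) *\<^sub>R x + u *\<^sub>R y \<in> {x \<in> S. f x < k}"
    using convexD_alt[OF convex_on_imp_convex[OF f] xy(1,2) u] by simp
qed

definition past_region :: "real \<Rightarrow> complex \<Rightarrow> real \<Rightarrow> complex set" where
  "past_region c t0 k = {t. Re (t - t0) + c * norm (t - t0) < k}"

lemma open_past_region: "open (past_region c t0 k)"
  unfolding past_region_def by (intro open_Collect_less continuous_intros)

lemma convex_past_region:
  assumes "c \<ge> 0"
  shows "convex (past_region c t0 k)"
proof -
  have "convex_on UNIV (\<lambda>t. c * dist t0 t)"
    using assms by (intro convex_on_cmul convex_on_dist) auto
  moreover have "convex_on UNIV (\<lambda>t. Re (t - t0))"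
    by (intro convex_onI) (auto simp: algebra_simps)
  ultimately have "convex_on UNIV (\<lambda>t. Re (t - t0) + c * norm (t - t0))"
    using convex_on_add by (fastforce simp: dist_norm norm_minus_commute)
  then show ?thesis
    using convex_on_imp_convex_sublevel[of UNIV] by (simp add: past_region_def)
qed

lemma backward_closed_past_region:
  assumes "0 \<le> c" "c \<le> 1"
  shows "backward_closed H (H \<inter> past_region c t0 k)"
  unfolding backward_closed_def
proof (intro ballI allI impI)
  fix t and s :: real
  assume t: "t \<in> H \<inter> past_region c t0 k" and "s \<ge> 0" and shifted: "t - of_real s \<in> H"
  have "norm (t - of_real s - t0) \<le> norm (t - t0) + s"
    using norm_triangle_ineq4[of "t - t0" "of_real s"] \<open>s \<ge> 0\<close> by (simp add: algebra_simps)
  then have "c * norm (t - of_real s - t0) \<le> c * norm (t - t0) + c * s"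
    using \<open>0 \<le> c\<close> mult_left_mono by (fastforce simp flip: distrib_left)
  also have "c * s \<le> s"
    using \<open>c \<le> 1\<close> \<open>s \<ge> 0\<close> mult_right_mono[of c 1 s] by simp
  finally show "t - of_real s \<in> H \<inter> past_region c t0 k"
    using t shifted by (simp add: past_region_def)
qed

lemma Re_reachable_less:
  assumes t: "t \<in> past_region c t0 k" and w: "w \<in> reachable 1 c t0 w0 t"
  shows "Re w < Re w0 + k"
proof -
  have "Re w - Re w0 - Re (t - t0) \<le> c * norm (t - t0)"
    using w complex_Re_le_cmod[of "w - (w0 + (t - t0))"]
    by (simp add: reachable_def dist_norm norm_minus_commute)
  then show ?thesis
    using t by (simp add: past_region_def)
qed

locale forward_ode =
  fixes H :: "complex set" and \<mu> c :: real and F :: "complex \<times> complex \<Rightarrow> complex"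
  assumes open_H: "open H" and convex_H: "convex H" and c_less_1: "c < 1"
    and holo2_F: "holo2 F (H \<times> {w. Re w < \<mu>})"
    and F_near_1: "\<And>t w. t \<in> H \<Longrightarrow> Re w < \<mu> \<Longrightarrow> norm (F (t, w) - 1) \<le> c"
begin

lemma F_lipschitz:
  assumes t: "t \<in> H" and "m < \<mu>"
  shows "(2 / (\<mu> - m))-lipschitz_on {w. Re w \<le> m} (\<lambda>w. F (t, w))"
proof -
  have "(\<lambda>w. F (t, w) - 1) holomorphic_on {w. Re w < \<mu>}"
    using t by (intro holomorphic_intros holomorphic_on_holo2_compose[OF holo2_F]
        open_Collect_less continuous_intros) auto
  moreover have "norm (F (t, w) - 1) \<le> 1" if "w \<in> {w. Re w < \<mu>}" for w
    using F_near_1[of t w] t that c_less_1 by simp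
  moreover have "cball w ((\<mu> - m) / 2) \<subseteq> {w. Re w < \<mu>}" if "w \<in> {w. Re w \<le> m}" for w
  proof
    fix y assume "y \<in> cball w ((\<mu> - m) / 2)"
    then have "Re y - Re w \<le> (\<mu> - m) / 2"
      using complex_Re_le_cmod[of "y - w"] by (simp add: dist_norm norm_minus_commute)
    then show "y \<in> {w. Re w < \<mu>}"
      using that \<open>m < \<mu>\<close> by (simp add: field_simps)
  qed
  ultimately have "(1 / ((\<mu> - m) / 2))-lipschitz_on {w. Re w \<le> m} (\<lambda>w. F (t, w) - 1)"
    using \<open>m < \<mu>\<close> by (intro holomorphic_bounded_imp_lipschitz_on convex_halfspace_Re_le) auto
  then show ?thesis
    by (simp add: lipschitz_on_def dist_norm)
qed

definition solution :: "complex set \<Rightarrow> (complex \<Rightarrow> complex) \<Rightarrow> bool" where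
  "solution U f \<longleftrightarrow> open U \<and> U \<subseteq> H \<and>
     (\<forall>t\<in>U. Re (f t) < \<mu> \<and> (f has_field_derivative F (t, f t)) (at t))"

lemma solution_subset: "solution U f \<Longrightarrow> V \<subseteq> U \<Longrightarrow> open V \<Longrightarrow> solution V f"
  by (auto simp: solution_def)

lemma solution_holomorphic_on: "solution U f \<Longrightarrow> f holomorphic_on U"
  by (auto simp: solution_def holomorphic_on_open)

lemma solution_if_locally_eq_solution:
  assumes "\<And>t. t \<in> U \<Longrightarrow> \<exists>V g. solution V g \<and> t \<in> V \<and> V \<subseteq> U \<and> (\<forall>s\<in>V. f s = g s)"
  shows "solution U f"
proof -
  have nbhd: "\<exists>V. open V \<and> t \<in> V \<and> V \<subseteq> U \<and> t \<in> H \<and> Re (f t) < \<mu> \<and>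
      (f has_field_derivative F (t, f t)) (at t)" if t: "t \<in> U" for t
  proof -
    obtain V g where V: "solution V g" "t \<in> V" "V \<subseteq> U" "\<And>s. s \<in> V \<Longrightarrow> f s = g s"
      using assms[OF t] by blast
    then have g: "open V" "V \<subseteq> H" "Re (g t) < \<mu>" "(g has_field_derivative F (t, g t)) (at t)"
      by (auto simp: solution_def)
    have "(f has_field_derivative F (t, f t)) (at t)"
      using has_field_derivative_transform_within_open[OF g(4,1) V(2), of f] V by simp
    then show ?thesis
      using V g by auto
  qed
  then have "open U"
    by (subst open_subopen) blast
  then show ?thesis
    using nbhd unfolding solution_def by blast
qed

lemma solutions_agree_on_cball:
  assumes f: "solution U f" and g: "solution V g" and UV: "cball t0 e \<subseteq> U \<inter> V"
    and "m < \<mu>" and Re_le: "\<And>t. t \<in> cball t0 e \<Longrightarrow> Re (f t) \<le> m \<and> Re (g t) \<le> m"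
    and "2 / (\<mu> - m) * e < 1" and "f t0 = g t0" and t: "t \<in> cball t0 e"
  shows "f t = g t"
proof -
  have "f t - g t = 0"
  proof (rule zero_on_cball_if_norm_deriv_le[OF _ _ _ _ \<open>2 / (\<mu> - m) * e < 1\<close> t])
    fix s assume s: "s \<in> cball t0 e"
    then have sol: "s \<in> U" "s \<in> V" "s \<in> H"
      using UV f by (auto simp: solution_def)
    then show "((\<lambda>t. f t - g t) has_field_derivative F (s, f s) - F (s, g s)) (at s)"
      using f g unfolding solution_def by (intro DERIV_diff) auto
    show "norm (F (s, f s) - F (s, g s)) \<le> 2 / (\<mu> - m) * norm (f s - g s)"
      using lipschitz_onD[OF F_lipschitz[OF sol(3) \<open>m < \<mu>\<close>], of "f s" "g s"] Re_le[OF s]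
      by (simp add: dist_norm)
  qed (use assms in auto)
  then show ?thesis
    by simp
qed

lemma open_solutions_agree:
  assumes f: "solution U f" and g: "solution V g"
  shows "open {t \<in> U \<inter> V. f t = g t}"
  unfolding open_contains_ball
proof
  fix t0 assume t0: "t0 \<in> {t \<in> U \<inter> V. f t = g t}"
  define m where "m = (Re (f t0) + \<mu>) / 2"
  have m: "Re (f t0) < m" "m < \<mu>"
    using f t0 by (auto simp: solution_def m_def)
  define N where "N = (U \<inter> V) \<inter> (\<lambda>t. (f t, g t)) -` ({w. Re w < m} \<times> {w. Re w < m})"
  have "open N"
    unfolding N_def
  proof (rule continuous_open_preimage)
    show "continuous_on (U \<inter> V) (\<lambda>t. (f t, g t))"
      using solution_holomorphic_on[OF f] solution_holomorphic_on[OF g]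
      by (intro continuous_on_Pair) (auto intro: holomorphic_on_imp_continuous_on continuous_on_subset)
    show "open (U \<inter> V)"
      using f g by (auto simp: solution_def)
    show "open ({w. Re w < m} \<times> {w. Re w < m})"
      by (intro open_Times open_halfspace_Re_lt)
  qed
  moreover have "t0 \<in> N"
    using t0 m by (simp add: N_def)
  ultimately obtain d where d: "d > 0" "cball t0 d \<subseteq> N"
    using open_contains_cball by blast
  define e where "e = min d ((\<mu> - m) / 4)"
  have e: "e > 0" "2 / (\<mu> - m) * e < 1"
    using d(1) m(2) by (auto simp: e_def min_def field_simps)
  have "cball t0 e \<subseteq> N"
    using d(2) by (auto simp: e_def)
  moreover from this have "f t = g t" if "t \<in> cball t0 e" for t
    using t0 by (intro solutions_agree_on_cball[OF f g _ m(2) _ e(2) _ that]) (force simp: N_def)+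
  ultimately show "\<exists>e>0. ball t0 e \<subseteq> {t \<in> U \<inter> V. f t = g t}"
    using e(1) by (intro exI[of _ e]) (auto simp: N_def)
qed

lemma solutions_agree:
  assumes f: "solution U f" and g: "solution V g" and "connected (U \<inter> V)"
    and t0: "t0 \<in> U \<inter> V" "f t0 = g t0" and t: "t \<in> U \<inter> V"
  shows "f t = g t"
proof (rule analytic_continuation_open[where f = f and g = g,
      OF open_solutions_agree[OF f g] _ _ \<open>connected (U \<inter> V)\<close>])
  show "open (U \<inter> V)"
    using f g by (auto simp: solution_def)
  show "f holomorphic_on U \<inter> V" "g holomorphic_on U \<inter> V"
    using f g solution_holomorphic_on holomorphic_on_subset by blast+
qed (use t0 t in auto)

definition backward_solution :: "complex set \<Rightarrow> (complex \<Rightarrow> complex) \<Rightarrow> bool" where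
  "backward_solution U f \<longleftrightarrow> solution U f \<and> connected U \<and> backward_closed H U"

lemma backward_solutions_agree:
  assumes f: "backward_solution U f" and g: "backward_solution V g"
    and "t0 \<in> U \<inter> V" "f t0 = g t0" "t \<in> U \<inter> V"
  shows "f t = g t"
proof (rule solutions_agree[of U f V g])
  show "connected (U \<inter> V)"
    using f g by (intro connected_Int_backward_closed[OF convex_H])
      (auto simp: backward_solution_def solution_def)
qed (use assms in \<open>auto simp: backward_solution_def\<close>)

lemma simply_connected_backward_solution: "backward_solution U f \<Longrightarrow> simply_connected U"
  using simply_connected_backward_closed[OF convex_H]
  by (auto simp: backward_solution_def solution_def)

lemma backward_solution_Union:
  assumes \<F>: "\<And>V g. (V, g) \<in> \<F> \<Longrightarrow> backward_solution V g \<and> t0 \<in> V \<and> g t0 = w0"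
  obtains f where "backward_solution (\<Union>(fst ` \<F>)) f" "\<And>V g t. (V, g) \<in> \<F> \<Longrightarrow> t \<in> V \<Longrightarrow> f t = g t"
proof -
  define f where "f t = (SOME w. \<exists>(V, g)\<in>\<F>. t \<in> V \<and> g t = w)" for t
  have f: "f t = g t" if Vg: "(V, g) \<in> \<F>" "t \<in> V" for V g t
  proof -
    have "\<exists>(W, h)\<in>\<F>. t \<in> W \<and> h t = f t"
      unfolding f_def by (rule someI[of _ "g t"]) (use Vg in blast)
    then obtain W h where Wh: "(W, h) \<in> \<F>" "t \<in> W" "h t = f t"
      by blast
    then have "h t = g t"
      using \<F>[OF Vg(1)] \<F>[OF Wh(1)] Vg(2) backward_solutions_agree[of W h V g t0 t] by auto
    with Wh(3) show ?thesis
      by simp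
  qed
  have "solution (\<Union>(fst ` \<F>)) f"
  proof (rule solution_if_locally_eq_solution)
    fix t assume "t \<in> \<Union>(fst ` \<F>)"
    then obtain V g where Vg: "(V, g) \<in> \<F>" "t \<in> V"
      by auto
    then show "\<exists>V g. solution V g \<and> t \<in> V \<and> V \<subseteq> \<Union>(fst ` \<F>) \<and> (\<forall>s\<in>V. f s = g s)"
      using \<F>[OF Vg(1)] f[OF Vg(1)] unfolding backward_solution_def
      by (intro exI[of _ V] exI[of _ g]) force
  qed
  moreover have "t0 \<in> \<Inter>(fst ` \<F>)"
    using \<F> by auto
  then have "connected (\<Union>(fst ` \<F>))"
    using \<F> by (intro connected_Union) (auto simp: backward_solution_def)
  moreover have "backward_closed H (\<Union>(fst ` \<F>))"
    using \<F> by (intro backward_closed_Union) (auto simp: backward_solution_def)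
  ultimately show ?thesis
    using that f unfolding backward_solution_def by blast
qed

lemma backward_solution_exists:
  assumes t0: "t0 \<in> H" and w0: "Re w0 < \<mu>"
  obtains D f where "backward_solution D f" "t0 \<in> D" "f t0 = w0"
proof -
  define m where "m = (Re w0 + \<mu>) / 2"
  have m: "Re w0 < m" "m < \<mu>"
    using w0 by (auto simp: m_def)
  have "c \<ge> 0"
    using order.trans[OF norm_ge_zero F_near_1[OF t0 w0]] .
  define D where "D = H \<inter> past_region c t0 (m - Re w0)"
  have Re_reachable: "Re w < m" if "t \<in> D" "w \<in> reachable 1 c t0 w0 t" for t w
    using Re_reachable_less[of t c t0 "m - Re w0" w w0] that by (simp add: D_def)
  interpret picard_iteration D t0 w0 1 c "2 / (\<mu> - m)" F
  proof
    show "open D"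
      unfolding D_def by (intro open_Int open_H open_past_region)
    show "convex D"
      unfolding D_def by (intro convex_Int convex_H convex_past_region \<open>c \<ge> 0\<close>)
    show "t0 \<in> D"
      using t0 m by (simp add: D_def past_region_def)
    show "holo2 F (Sigma D (reachable 1 c t0 w0))"
      using Re_reachable m(2) by (intro holo2_subset[OF holo2_F]) (fastforce simp: D_def)
    fix t assume t: "t \<in> D"
    then show "F (t, w) \<in> cball 1 c" if "w \<in> reachable 1 c t0 w0 t" for w
      using F_near_1[of t w] Re_reachable[OF t that] m by (simp add: D_def dist_norm norm_minus_commute)
    show "(2 / (\<mu> - m))-lipschitz_on (reachable 1 c t0 w0 t) (\<lambda>w. F (t, w))"
      using t less_imp_le[OF Re_reachable[OF t]]
      by (intro lipschitz_on_subset[OF F_lipschitz[OF _ m(2)]]) (auto simp: D_def)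
  qed (use m in auto)
  have "solution D limit"
    using open_D has_field_derivative_limit Re_reachable limit_in_reach m
    unfolding solution_def D_def by fastforce
  then have "backward_solution D limit"
    using convex_D \<open>c \<ge> 0\<close> c_less_1 backward_closed_past_region
    by (simp add: backward_solution_def convex_connected D_def)
  then show ?thesis
    using that t0_in_D limit_initial by blast
qed

definition maximal_solution :: "complex set \<Rightarrow> (complex \<Rightarrow> complex) \<Rightarrow> bool" where
  "maximal_solution U f \<longleftrightarrow> backward_solution U f \<and>
     (\<forall>V g t. backward_solution V g \<longrightarrow> t \<in> U \<inter> V \<longrightarrow> f t = g t \<longrightarrow> V \<subseteq> U)"

lemma maximal_solution_exists:
  assumes "t0 \<in> H" "Re w0 < \<mu>"
  obtains U f where "maximal_solution U f" "t0 \<in> U" "f t0 = w0"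
proof -
  define \<F> where "\<F> = {(V, g). backward_solution V g \<and> t0 \<in> V \<and> g t0 = w0}"
  define U where "U = \<Union>(fst ` \<F>)"
  obtain f where f: "backward_solution U f" and f_eq: "\<And>V g t. (V, g) \<in> \<F> \<Longrightarrow> t \<in> V \<Longrightarrow> f t = g t"
    unfolding U_def by (rule backward_solution_Union[of \<F> t0 w0]) (auto simp: \<F>_def)
  obtain D g where "(D, g) \<in> \<F>"
    using backward_solution_exists[OF assms] unfolding \<F>_def by blast
  then have t0: "t0 \<in> U" "f t0 = w0"
    using f_eq[of D g t0] by (auto simp: U_def \<F>_def)
  have "V \<subseteq> U" if g: "backward_solution V g" and t: "t \<in> U \<inter> V" "f t = g t" for V g t
  proof -
    obtain h where "backward_solution (\<Union>(fst ` {(U, f), (V, g)})) h"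
      "\<And>s. s \<in> U \<Longrightarrow> h s = f s"
      by (rule backward_solution_Union[of "{(U, f), (V, g)}" t "f t"]) (use f g t in auto)
    then have "(U \<union> V, h) \<in> \<F>"
      using t0 by (simp add: \<F>_def)
    then show ?thesis
      unfolding U_def by force
  qed
  then show ?thesis
    using that f t0 unfolding maximal_solution_def by blast
qed

end

subsection \<open>Leaves as graphs of maximal solutions\<close>

lemma integral_curve_iff:
  "integral_curve V S D \<gamma> \<longleftrightarrow> open D \<and> connected D \<and> \<gamma> ` D \<subseteq> S \<and>
     (\<forall>t\<in>D. ((\<lambda>t. fst (\<gamma> t)) has_field_derivative fst (V (\<gamma> t))) (at t) \<and>
           ((\<lambda>t. snd (\<gamma> t)) has_field_derivative snd (V (\<gamma> t))) (at t))"
proof -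
  have "(\<gamma> has_derivative (\<lambda>h. (h * x, h * y))) (at t) \<longleftrightarrow>
      ((\<lambda>t. fst (\<gamma> t)) has_field_derivative x) (at t) \<and>
      ((\<lambda>t. snd (\<gamma> t)) has_field_derivative y) (at t)" for x y t
  proof -
    have "(\<gamma> has_derivative (\<lambda>h. (h * x, h * y))) (at t)"
      if "((\<lambda>t. fst (\<gamma> t)) has_derivative (\<lambda>h. h * x)) (at t)"
        "((\<lambda>t. snd (\<gamma> t)) has_derivative (\<lambda>h. h * y)) (at t)"
      using has_derivative_Pair[OF that] by simp
    then show ?thesis
      unfolding has_field_derivative_def mult_commute_abs
      by (auto simp: mult_commute_abs dest: has_derivative_fst has_derivative_snd)
  qed
  then show ?thesis
    by (simp add: integral_curve_def)
qed

definition half_plane :: "complex \<Rightarrow> real \<Rightarrow> complex set" where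
  "half_plane a k = {t. Re (a * t) < k}"

lemma open_half_plane: "open (half_plane a k)"
  unfolding half_plane_def by (intro open_Collect_less continuous_intros)

lemma convex_half_plane: "convex (half_plane a k)"
proof -
  have "half_plane a k = {t. inner (cnj a) t < k}"
    by (simp add: half_plane_def inner_complex_def)
  then show ?thesis
    by (simp add: convex_halfspace_lt)
qed

lemma fst_pullback_field [simp]: "fst (pullback_field lam R p) = lam"
  by (simp add: pullback_field_def)

lemma covE_in_polydisc_iff:
  assumes "\<rho> > 0" "r > 0"
  shows "covE p \<in> polydisc \<rho> r \<longleftrightarrow> p \<in> cover_dom \<rho> r"
proof -
  have "exp x < k \<longleftrightarrow> x < ln k" if "k > 0" for x k :: real
    using that by (metis exp_less_cancel_iff exp_ln)
  then show ?thesis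
    using assms by (cases p) (simp add: covE_def polydisc_def cover_dom_def)
qed

locale pullback_foliation =
  fixes lam :: complex and \<rho> r c :: real and R :: "complex \<times> complex \<Rightarrow> complex"
  assumes lam_nonzero: "lam \<noteq> 0" and \<rho>_pos: "\<rho> > 0" and r_pos: "r > 0" and c_less_1: "c < 1"
    and holo2_R: "holo2 R (polydisc \<rho> r)"
    and norm_R_le: "\<And>p. p \<in> polydisc \<rho> r \<Longrightarrow> norm (R p) \<le> c"
begin

abbreviation "V \<equiv> pullback_field lam R"
abbreviation "S \<equiv> cover_dom \<rho> r"
abbreviation "X \<equiv> leaf_topology V S"
abbreviation "H \<equiv> half_plane lam (ln \<rho>)"

lemma mem_cover_dom_iff: "(lam * t, w) \<in> S \<longleftrightarrow> t \<in> H \<and> Re w < ln r"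
  by (simp add: cover_dom_def half_plane_def)

lemma covE_in_polydisc: "t \<in> H \<Longrightarrow> Re w < ln r \<Longrightarrow> covE (lam * t, w) \<in> polydisc \<rho> r"
  using covE_in_polydisc_iff[OF \<rho>_pos r_pos] mem_cover_dom_iff by blast

sublocale forward_ode H "ln r" c "\<lambda>(t, w). snd (V (lam * t, w))"
proof
  have "holo2 (\<lambda>(t, w). 1 + R (exp (lam * t), exp w)) (H \<times> {w. Re w < ln r})"
    using covE_in_polydisc
    by (intro holo2_compose_Times[OF holo2_const_add[OF holo2_R]] open_half_plane open_halfspace_Re_lt
        holomorphic_intros) (auto simp: covE_def)
  then show "holo2 (\<lambda>(t, w). snd (V (lam * t, w))) (H \<times> {w. Re w < ln r})"
    by (simp add: pullback_field_def covE_def)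
  fix t w assume "t \<in> H" "Re w < ln r"
  then show "norm ((case (t, w) of (t, w) \<Rightarrow> snd (V (lam * t, w))) - 1) \<le> c"
    using norm_R_le[OF covE_in_polydisc] by (simp add: pullback_field_def)
qed (fact open_half_plane convex_half_plane c_less_1)+

lemma cover_dom_cases:
  assumes "p \<in> S"
  obtains t w where "p = (lam * t, w)" "t \<in> H" "Re w < ln r"
proof -
  have "p = (lam * (fst p / lam), snd p)"
    using lam_nonzero by simp
  then show ?thesis
    using assms mem_cover_dom_iff that by metis
qed

definition graph :: "complex set \<Rightarrow> (complex \<Rightarrow> complex) \<Rightarrow> (complex \<times> complex) set" where
  "graph U f = (\<lambda>t. (lam * t, f t)) ` U"

lemma mem_graph_iff: "(lam * t, w) \<in> graph U f \<longleftrightarrow> t \<in> U \<and> w = f t"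
  using lam_nonzero by (auto simp: graph_def)

lemma integral_curve_solution:
  assumes "solution U f" "connected U"
  shows "integral_curve V S U (\<lambda>t. (lam * t, f t))"
  using assms
  by (auto simp: integral_curve_iff solution_def mem_cover_dom_iff
      intro!: derivative_eq_intros)

lemma integral_curve_fst:
  assumes \<gamma>: "integral_curve V S D \<gamma>"
  shows "\<exists>a. \<forall>t\<in>D. fst (\<gamma> t) = lam * (a + t)"
proof -
  have D: "open D" "connected D"
    using \<gamma> by (auto simp: integral_curve_def)
  have deriv: "((\<lambda>t. fst (\<gamma> t) - lam * t) has_field_derivative 0) (at t)" if "t \<in> D" for t
    using \<gamma> that by (auto simp: integral_curve_iff intro!: derivative_eq_intros)
  then have "continuous_on D (\<lambda>t. fst (\<gamma> t) - lam * t)"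
    by (intro continuous_at_imp_continuous_on ballI DERIV_isCont)
  then obtain k where const: "\<And>t. t \<in> D \<Longrightarrow> fst (\<gamma> t) - lam * t = k"
    using DERIV_zero_connected_constant[OF D(2,1) finite.emptyI] deriv by auto
  have "fst (\<gamma> t) = lam * (k / lam + t)" if "t \<in> D" for t
    using const[OF that] lam_nonzero by (simp add: algebra_simps)
  then show ?thesis
    by blast
qed

lemma integral_curve_image_is_graph:
  assumes \<gamma>: "integral_curve V S D \<gamma>" and W: "open W" "W \<subseteq> D"
  obtains U f where "solution U f" "\<gamma> ` W = graph U f"
proof -
  obtain a where a: "\<And>t. t \<in> D \<Longrightarrow> fst (\<gamma> t) = lam * (a + t)"
    using integral_curve_fst[OF \<gamma>] by blast
  define f where "f t = snd (\<gamma> (t - a))" for t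
  have eq: "\<gamma> t = (lam * (a + t), f (a + t))" if "t \<in> W" for t
    using a[of t] that W(2) by (auto simp: f_def prod_eq_iff)
  have in_domain: "a + t \<in> H" "Re (f (a + t)) < ln r" if "t \<in> W" for t
  proof -
    have "(lam * (a + t), f (a + t)) \<in> S"
      unfolding eq[OF that, symmetric] using \<gamma> that W(2) by (auto simp: integral_curve_def)
    then show "a + t \<in> H" "Re (f (a + t)) < ln r"
      by (simp_all only: mem_cover_dom_iff)
  qed
  have deriv: "(f has_field_derivative snd (V (lam * (a + t), f (a + t)))) (at (a + t))"
    if t: "t \<in> W" for t
  proof -
    have "((\<lambda>t. snd (\<gamma> t)) has_field_derivative snd (V (\<gamma> t))) (at t)"
      using \<gamma> t W(2) by (auto simp: integral_curve_iff)
    then have "(f has_field_derivative snd (V (\<gamma> t))) (at (a + t))"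
      unfolding f_def[abs_def] using DERIV_shift[of "\<lambda>t. snd (\<gamma> t)" _ "a + t" "- a"] by simp
    then show ?thesis
      by (simp only: eq[OF t])
  qed
  have "solution ((+) a ` W) f"
    unfolding solution_def using open_translation[OF W(1)] in_domain deriv by auto
  moreover have "\<gamma> ` W = graph ((+) a ` W) f"
    unfolding graph_def image_image by (intro image_cong refl eq)
  ultimately show ?thesis
    by (rule that)
qed

lemma openin_graph:
  assumes f: "solution U f"
  shows "openin X (graph U f)"
proof (subst openin_subopen, intro ballI)
  fix q assume "q \<in> graph U f"
  then obtain t where t: "t \<in> U" "q = (lam * t, f t)"
    by (auto simp: graph_def)
  obtain e where e: "e > 0" "ball t e \<subseteq> U"
    using t f open_contains_ball unfolding solution_def by blast
  have "integral_curve V S (ball t e) (\<lambda>t. (lam * t, f t))"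
    using e solution_subset[OF f] by (intro integral_curve_solution) auto
  then have "openin X (graph (ball t e) f)"
    unfolding leaf_topology_def graph_def by (intro topology_generated_by_Basis) blast
  then show "\<exists>T. openin X T \<and> q \<in> T \<and> T \<subseteq> graph U f"
    using t e by (intro exI[of _ "graph (ball t e) f"]) (auto simp: graph_def)
qed

lemma graph_subset_topspace: "solution U f \<Longrightarrow> graph U f \<subseteq> topspace X"
  by (intro openin_subset openin_graph)

lemma continuous_map_graph:
  assumes f: "solution U f"
  shows "continuous_map (top_of_set U) X (\<lambda>t. (lam * t, f t))"
proof -
  have "openin (top_of_set U) ((\<lambda>t. (lam * t, f t)) -` (\<gamma> ` W) \<inter> U)"
    if W: "integral_curve V S D \<gamma>" "open W" "W \<subseteq> D" for \<gamma> D W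
  proof -
    obtain U' g where g: "solution U' g" "\<gamma> ` W = graph U' g"
      by (rule integral_curve_image_is_graph[OF W])
    have "(\<lambda>t. (lam * t, f t)) -` (\<gamma> ` W) \<inter> U = {t \<in> U \<inter> U'. f t = g t}"
      by (auto simp: g(2) mem_graph_iff)
    then show ?thesis
      using open_solutions_agree[OF f g(1)] by (auto intro: open_subset)
  qed
  moreover have "(\<lambda>t. (lam * t, f t)) ` U \<subseteq> topspace X"
    using graph_subset_topspace[OF f] by (simp add: graph_def)
  ultimately show ?thesis
    unfolding leaf_topology_def topology_generated_by_topspace
    by (intro continuous_on_generated_topo) auto
qed

lemma topspace_leaf_topology: "topspace X \<subseteq> S"
  unfolding leaf_topology_def topology_generated_by_topspace by (auto simp: integral_curve_def)

lemma closedin_graph: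
  assumes U: "maximal_solution U f"
  shows "closedin X (graph U f)"
  unfolding closedin_def
proof
  have "solution U f"
    using U by (simp add: maximal_solution_def backward_solution_def)
  then show "graph U f \<subseteq> topspace X"
    by (rule graph_subset_topspace)
  show "openin X (topspace X - graph U f)"
  proof (subst openin_subopen, intro ballI)
    fix q assume q: "q \<in> topspace X - graph U f"
    then obtain t w where tw: "q = (lam * t, w)" "t \<in> H" "Re w < ln r"
      using topspace_leaf_topology cover_dom_cases by blast
    then obtain D g where g: "backward_solution D g" "t \<in> D" "g t = w"
      using backward_solution_exists by blast
    then have sol: "solution D g"
      by (simp add: backward_solution_def)
    have "graph D g \<inter> graph U f = {}"
    proof (rule ccontr)
      assume "graph D g \<inter> graph U f \<noteq> {}"
      then obtain s where "s \<in> U \<inter> D" "f s = g s"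
        using lam_nonzero by (fastforce simp: graph_def)
      then have "D \<subseteq> U" "f t = g t"
        using U g backward_solutions_agree[of U f D g s t] unfolding maximal_solution_def by blast+
      then show False
        using q tw g by (auto simp: mem_graph_iff)
    qed
    then show "\<exists>T. openin X T \<and> q \<in> T \<and> T \<subseteq> topspace X - graph U f"
      using openin_graph[OF sol] graph_subset_topspace[OF sol] g tw
      by (intro exI[of _ "graph D g"]) (auto simp: mem_graph_iff)
  qed
qed

lemma leaf_eq_graph:
  assumes U: "maximal_solution U f" and t0: "t0 \<in> U"
  shows "leaf V S (lam * t0, f t0) = graph U f"
proof -
  let ?p = "(lam * t0, f t0)"
  have f: "solution U f" "connected U"
    using U by (auto simp: maximal_solution_def backward_solution_def)
  have p: "?p \<in> graph U f"
    using t0 by (simp add: mem_graph_iff)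
  have "connectedin X (graph U f)"
    using connectedin_continuous_map_image[OF continuous_map_graph[OF f(1)], of U] f(2)
    by (simp add: graph_def connectedin_subtopology)
  then have sub: "graph U f \<subseteq> connected_component_of_set X ?p"
    using p by (rule connected_component_of_maximal)
  moreover have "connected_component_of_set X ?p \<subseteq> graph U f"
    using connectedin_clopen_cases[OF connectedin_connected_component_of closedin_graph[OF U]
        openin_graph[OF f(1)], of ?p] p sub by (auto simp: disjnt_iff)
  ultimately show ?thesis
    by (auto simp: leaf_def)
qed

lemma retraction_map_graph:
  assumes f: "solution U f"
  shows "retraction_map (top_of_set U) (subtopology X (graph U f)) (\<lambda>t. (lam * t, f t))"
  unfolding retraction_map_def retraction_maps_def
proof (intro exI conjI ballI)
  let ?Y = "subtopology X (graph U f)"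
  have topspace: "topspace ?Y = graph U f"
    using graph_subset_topspace[OF f] by auto
  show "continuous_map (top_of_set U) ?Y (\<lambda>t. (lam * t, f t))"
    using continuous_map_graph[OF f] by (intro continuous_map_into_subtopology) (auto simp: graph_def)
  show "(lam * (fst q / lam), f (fst q / lam)) = q" if "q \<in> topspace ?Y" for q
    using that lam_nonzero unfolding topspace by (auto simp: graph_def)
  show "continuous_map ?Y (top_of_set U) (\<lambda>q. fst q / lam)"
    unfolding continuous_map_def topspace
  proof (intro conjI allI impI)
    show "(\<lambda>q. fst q / lam) \<in> graph U f \<rightarrow> topspace (top_of_set U)"
      using lam_nonzero by (auto simp: graph_def)
    fix W assume "openin (top_of_set U) W"
    then have W: "open W" "W \<subseteq> U"
      using f by (auto simp: solution_def openin_open_eq)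
    have "{q \<in> graph U f. fst q / lam \<in> W} = graph W f"
      using lam_nonzero W(2) by (auto simp: graph_def)
    moreover have "openin X (graph W f)"
      using W by (intro openin_graph solution_subset[OF f])
    moreover have "graph W f \<subseteq> graph U f"
      using W(2) by (auto simp: graph_def)
    ultimately show "openin ?Y {q \<in> graph U f. fst q / lam \<in> W}"
      by (auto simp: openin_subtopology)
  qed
qed

lemma simply_connected_leaf:
  assumes "p \<in> S"
  shows "simply_connected_space (subtopology X (leaf V S p))"
proof -
  obtain t w where p: "p = (lam * t, w)" "t \<in> H" "Re w < ln r"
    using cover_dom_cases[OF assms] .
  obtain U f where U: "maximal_solution U f" "t \<in> U" "f t = w"
    using maximal_solution_exists[OF p(2,3)] .
  then have f: "backward_solution U f" "solution U f"
    by (auto simp: maximal_solution_def backward_solution_def)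
  have "simply_connected_space (subtopology X (graph U f))"
    using retraction_map_graph[OF f(2)]
      simply_connected_space_top_of_set[OF simply_connected_backward_solution[OF f(1)]]
    by (rule simply_connected_space_retraction_map_image)
  then show ?thesis
    using leaf_eq_graph[OF U(1,2)] p U by simp
qed

end

theorem theorem1:
  fixes lam :: complex and a :: nat and R :: "complex \<times> complex \<Rightarrow> complex"
    and \<rho> r :: real
  assumes "lam \<noteq> 0"
    and "a > 0"
    and "\<rho> > 0" and "r > 0"
    and "holo2 R (polydisc \<rho> r)"
    and "\<exists>S. holo2 S (polydisc \<rho> r) \<and> (\<forall>(x, y)\<in>polydisc \<rho> r. R (x, y) = x ^ a * S (x, y))"
    and "bounded (R ` polydisc \<rho> r)"
    and "(SUP p\<in>polydisc \<rho> r. norm (R p)) < 1"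
  shows "(\<forall>p\<in>cover_dom \<rho> r. pullback_field lam R p \<noteq> 0) \<and>
         (\<forall>p\<in>cover_dom \<rho> r.
            simply_connected_space
              (subtopology (leaf_topology (pullback_field lam R) (cover_dom \<rho> r))
                 (leaf (pullback_field lam R) (cover_dom \<rho> r) p)))"
proof -
  have "bdd_above ((\<lambda>p. norm (R p)) ` polydisc \<rho> r)"
    using \<open>bounded (R ` polydisc \<rho> r)\<close> by (auto simp: bounded_iff bdd_above_def)
  then interpret pullback_foliation lam \<rho> r "SUP p\<in>polydisc \<rho> r. norm (R p)" R
    using assms by unfold_locales (auto intro: cSUP_upper)
  show ?thesis
    using simply_connected_leaf lam_nonzero by (auto simp: pullback_field_def zero_prod_def)
qed

end
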